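(* Let $d\ge1$ be fixed, let $q\ge d$ be an integer, and let $N=2^{q-d}$. Let the classic, modified and Chebyshev Gauss--Lobatto (CGL) sparse grids, the basis functions $u^i_k$, the grid-point errors $\epsilon^{\mathbf i}_{\mathbf k}$ and the propagated error function $e_{\text{BVP}}$ on $[0,1]^d$ be as defined in the context, and let $\epsilon>0$ satisfy $|\epsilon^{\mathbf i}_{\mathbf k}|<\epsilon$ for all multi-indices $\mathbf i$ with $|\mathbf i|\le q$ and all $1\le\mathbf k\le N_{\mathbf i}$. For the classic or the modified sparse grid and piecewise linear interpolation, $$\frac{\|e_{\text{BVP}}\|_{L^\infty}}{\epsilon}=O\!\left((\log N)^{d-1}\right).$$ For the CGL sparse grid and polynomial interpolation, $$\frac{\|e_{\text{BVP}}\|_{L^\infty}}{\epsilon}=O\!\left((\log N)^{2d-1}\right).$$ Here the $O$-notation refers to $q\to\infty$ with $d$ fixed; the implied constants do not depend on $q$, $\epsilon$ or the errors $\epsilon^{\mathbf i}_{\mathbf k}$.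
   Context: Node families. For each integer $i\ge1$, $X^i=\{x^i_1,\dots,x^i_{N_i}\}\subset[0,1]$ with $N_i$ points, given as follows. - Classic: $N_i=2^{i-1}+1$ and $X^i=\{\frac{k-1}{2^{i-1}}: k=1,\dots,N_i\}$ for all $i\ge1$. - Modified: $N_1=1$, $X^1=\{\tfrac12\}$; for $i>1$, $N_i=2^{i-1}+1$ and $X^i=\{\frac{k-1}{2^{i-1}}: k=1,\dots,N_i\}$. - CGL: $N_1=1$, $X^1=\{\tfrac12\}$; for $i>1$, $N_i=2^{i-1}+1$ and $X^i=\{\frac12(1-\cos\frac{(k-1)\pi}{2^{i-1}}): k=1,\dots,N_i\}$. Basis functions. For the classic and modified grids (piecewise linear interpolation), $u^i_k:[0,1]\to\mathbb R$ is the continuous function that equals $1$ at $x^i_k$, equals $0$ at the other points of $X^i$, and is linear between consecutive points of $X^i$; for the modified grid $u^1_1\equiv1$. For the CGL grid (polynomial interpolation), $u^i_k$ is the Lagrange polynomial $u^i_k(x)=\prod_{y\in X^i,\,y\ne x^i_k}\frac{x-y}{x^i_k-y}$, with $u^1_1\equiv1$. Multi-indices. $\mathbf i=(i_1,\dots,i_d)$ with all $i_j\ge1$, $|\mathbf i|=i_1+\cdots+i_d$; $1\le\mathbf k\le N_{\mathbf i}$ means $1\le k_j\le N_{i_j}$ for $j=1,\dots,d$; $x^{\mathbf i}_{\mathbf k}=(x^{i_1}_{k_1},\dots,x^{i_d}_{k_d})$; and $(u^{i_1}_{k_1}\otimes\cdots\otimes u^{i_d}_{k_d})(x_1,\dots,x_d)=u^{i_1}_{k_1}(x_1)\cdots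 u^{i_d}_{k_d}(x_d)$. Sparse grid. With $\Delta X^1=X^1$, $\Delta X^i=X^i\setminus X^{i-1}$ for $i\ge2$, and $\Delta X^{\mathbf i}=\Delta X^{i_1}\times\cdots\times\Delta X^{i_d}$, the sparse grid is $G^q_{\text{sparse}}=\bigcup_{|\mathbf i|\le q}\Delta X^{\mathbf i}$ (it contains every $x^{\mathbf i}_{\mathbf k}$ with $|\mathbf i|\le q$). Errors. A function $V$ on $[0,1]^d$ (a value function at a fixed time) is approximated at every sparse grid point by a numerical value $\bar V$. For $|\mathbf i|\le q$ put $\epsilon^{\mathbf i}_{\mathbf k}=\bar V(x^{\mathbf i}_{\mathbf k})-V(x^{\mathbf i}_{\mathbf k})$. The sparse grid interpolation operator is $$\mathcal I^q(f)=\sum_{q-d+1\le|\mathbf i|\le q}\ \sum_{1\le\mathbf k\le N_{\mathbf i}}(-1)^{q-|\mathbf i|}\binom{d-1}{q-|\mathbf i|}f(x^{\mathbf i}_{\mathbf k})\,u^{i_1}_{k_1}\otimes\cdots\otimes u^{i_d}_{k_d},$$ and $e_{\text{BVP}}=\mathcal I^q(\bar V)-\mathcal I^q(V)$, that is, $$e_{\text{BVP}}=\sum_{q-d+1\le|\mathbf i|\le q}\ \sum_{1\le\mathbf k\le N_{\mathbf i}}(-1)^{q-|\mathbf i|}\binom{d-1}{q-|\mathbf i|}\,\epsilon^{\mathbf i}_{\mathbf k}\,u^{i_1}_{k_1}\otimes\cdots\otimes u^{i_d}_{k_d}.$$ $\|\cdot\|_{L^\infty}$ is the supremum norm on $[0,1]^d$.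 *)

theory Defs
  imports "HOL-Analysis.Analysis"
begin

datatype grid = Classic | Modified | CGL

definition num_nodes :: "grid \<Rightarrow> nat \<Rightarrow> nat" where
  "num_nodes g i = (if g \<noteq> Classic \<and> i = 1 then 1 else 2 ^ (i - 1) + 1)"

definition node :: "grid \<Rightarrow> nat \<Rightarrow> nat \<Rightarrow> real" where
  "node g i k =
     (if g \<noteq> Classic \<and> i = 1 then 1 / 2
      else if g = CGL then (1 - cos ((real k - 1) * pi / 2 ^ (i - 1))) / 2
      else (real k - 1) / 2 ^ (i - 1))"

definition nodes :: "grid \<Rightarrow> nat \<Rightarrow> real set" where
  "nodes g i = node g i ` {1..num_nodes g i}"

text \<open>
  The function that is \<open>1\<close> at \<open>y\<close>, \<open>0\<close> at the other points of \<open>X\<close>, and linear (affine)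
  between consecutive points of \<open>X\<close>. It lives on \<open>[0,1]\<close>; extensionality fixes its irrelevant
  values outside.
\<close>

definition is_hat :: "real set \<Rightarrow> real \<Rightarrow> (real \<Rightarrow> real) \<Rightarrow> bool" where
  "is_hat X y u \<longleftrightarrow>
     u \<in> extensional {0..1} \<and> continuous_on {0..1} u \<and>
     u y = 1 \<and> (\<forall>z\<in>X - {y}. u z = 0) \<and>
     (\<forall>a\<in>X. \<forall>b\<in>X. a < b \<and> X \<inter> {a<..<b} = {} \<longrightarrow>
        (\<exists>m c. \<forall>t\<in>{a..b}. u t = m * t + c))"

definition hat :: "real set \<Rightarrow> real \<Rightarrow> real \<Rightarrow> real" where
  "hat X y = (THE u. is_hat X y u)"

definition lagrange :: "real set \<Rightarrow> real \<Rightarrow> real \<Rightarrow> real" where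
  "lagrange X y t = (\<Prod>z\<in>X - {y}. (t - z) / (y - z))"

definition basis_fun :: "grid \<Rightarrow> nat \<Rightarrow> nat \<Rightarrow> real \<Rightarrow> real" where
  "basis_fun g i k =
     (if g \<noteq> Classic \<and> i = 1 then (\<lambda>t. 1)
      else if g = CGL then lagrange (nodes g i) (node g i k)
      else hat (nodes g i) (node g i k))"

text \<open>The dimension is \<open>d = CARD('d)\<close>; multi-indices are functions on the index type \<open>'d\<close>.\<close>

definition msize :: "('d::finite \<Rightarrow> nat) \<Rightarrow> nat" where
  "msize i = (\<Sum>j\<in>UNIV. i j)"

definition multi_indices :: "nat set \<Rightarrow> ('d::finite \<Rightarrow> nat) set" where
  "multi_indices S = {i. (\<forall>j. 1 \<le> i j) \<and> msize i \<in> S}"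

definition node_indices :: "grid \<Rightarrow> ('d::finite \<Rightarrow> nat) \<Rightarrow> ('d \<Rightarrow> nat) set" where
  "node_indices g i = {k. \<forall>j. 1 \<le> k j \<and> k j \<le> num_nodes g (i j)}"

definition grid_point :: "grid \<Rightarrow> ('d::finite \<Rightarrow> nat) \<Rightarrow> ('d \<Rightarrow> nat) \<Rightarrow> real ^ 'd" where
  "grid_point g i k = (\<chi> j. node g (i j) (k j))"

definition tensor_basis :: "grid \<Rightarrow> ('d::finite \<Rightarrow> nat) \<Rightarrow> ('d \<Rightarrow> nat) \<Rightarrow> real ^ 'd \<Rightarrow> real" where
  "tensor_basis g i k x = (\<Prod>j\<in>UNIV. basis_fun g (i j) (k j) (x $ j))"

definition new_nodes :: "grid \<Rightarrow> nat \<Rightarrow> real set" where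
  "new_nodes g i = (if i = 1 then nodes g 1 else nodes g i - nodes g (i - 1))"

definition sparse_grid :: "grid \<Rightarrow> nat \<Rightarrow> (real ^ 'd::finite) set" where
  "sparse_grid g q = (\<Union>i\<in>multi_indices {..q}. {x. \<forall>j. x $ j \<in> new_nodes g (i j)})"

definition sparse_interp :: "grid \<Rightarrow> nat \<Rightarrow> (real ^ 'd::finite \<Rightarrow> real) \<Rightarrow> real ^ 'd \<Rightarrow> real" where
  "sparse_interp g q f x =
     (\<Sum>i\<in>multi_indices {q - CARD('d) + 1..q}. \<Sum>k\<in>node_indices g i.
        (- 1) ^ (q - msize i) * real ((CARD('d) - 1) choose (q - msize i)) *
        f (grid_point g i k) * tensor_basis g i k x)"

text \<open>
  Both the value function \<open>V\<close> and its approximation \<open>W\<close> are total functions here, but only their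
  values at the points of \<^term>\<open>sparse_grid g q\<close> enter (see \<open>grid_point_in_sparse_grid\<close> below).
\<close>

definition point_error ::
    "grid \<Rightarrow> (real ^ 'd::finite \<Rightarrow> real) \<Rightarrow> (real ^ 'd \<Rightarrow> real) \<Rightarrow> ('d \<Rightarrow> nat) \<Rightarrow> ('d \<Rightarrow> nat) \<Rightarrow> real" where
  "point_error g W V i k = W (grid_point g i k) - V (grid_point g i k)"

definition e_bvp ::
    "grid \<Rightarrow> nat \<Rightarrow> (real ^ 'd::finite \<Rightarrow> real) \<Rightarrow> (real ^ 'd \<Rightarrow> real) \<Rightarrow> real ^ 'd \<Rightarrow> real" where
  "e_bvp g q W V x = sparse_interp g q W x - sparse_interp g q V x"

definition sup_norm :: "(real ^ 'd::finite \<Rightarrow> real) \<Rightarrow> real" where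
  "sup_norm f = (SUP x\<in>{x. \<forall>j. 0 \<le> x $ j \<and> x $ j \<le> 1}. \<bar>f x\<bar>)"


lemma finite_multi_indices: "finite (multi_indices {a..q} :: ('d::finite \<Rightarrow> nat) set)"
proof (rule finite_subset)
  show "multi_indices {a..q} \<subseteq> (Pi\<^sub>E UNIV (\<lambda>_. {..q}) :: ('d \<Rightarrow> nat) set)"
  proof (clarsimp simp: multi_indices_def msize_def PiE_UNIV_domain)
    fix i :: "'d \<Rightarrow> nat" and j
    assume "sum i UNIV \<le> q"
    moreover have "i j \<le> sum i UNIV" by (rule member_le_sum) auto
    ultimately show "i j \<le> q" by linarith
  qed
qed (auto intro: finite_PiE)

lemma finite_node_indices: "finite (node_indices g (i :: 'd::finite \<Rightarrow> nat))"
proof (rule finite_subset)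
  show "node_indices g i \<subseteq> Pi\<^sub>E UNIV (\<lambda>j. {..num_nodes g (i j)})"
    by (auto simp: node_indices_def)
qed (auto intro: finite_PiE)

lemma grid_point_in_sparse_grid:
  fixes i :: "'d::finite \<Rightarrow> nat"
  assumes i: "i \<in> multi_indices {..q}" and k: "k \<in> node_indices g i"
  shows "grid_point g i k \<in> sparse_grid g q"
proof -
  define x where "x j = node g (i j) (k j)" for j
  define l where "l j = (LEAST m. 1 \<le> m \<and> x j \<in> nodes g m)" for j
  have P: "1 \<le> i j \<and> x j \<in> nodes g (i j)" for j
    using i k by (auto simp: multi_indices_def node_indices_def nodes_def x_def)
  have l: "1 \<le> l j \<and> x j \<in> nodes g (l j)" and le: "l j \<le> i j" for j
    unfolding l_def using P by (rule LeastI, rule Least_le)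
  have new: "x j \<in> new_nodes g (l j)" for j
  proof (cases "l j = 1")
    case False
    then have "l j - 1 < l j" "1 \<le> l j - 1" using l[of j] by auto
    then have "x j \<notin> nodes g (l j - 1)"
      unfolding l_def using not_less_Least by blast
    with False l[of j] show ?thesis by (simp add: new_nodes_def)
  qed (use l[of j] in \<open>simp add: new_nodes_def\<close>)
  have "msize l \<le> msize i" unfolding msize_def by (rule sum_mono) (rule le)
  then have "l \<in> multi_indices {..q}" using i l by (auto simp: multi_indices_def)
  then show ?thesis using new by (auto simp: sparse_grid_def grid_point_def x_def)
qed

lemma is_hat_unique:
  assumes fin: "finite X" and X: "0 \<in> X" "1 \<in> X" "X \<subseteq> {0..1}"
    and u: "is_hat X y u" and v: "is_hat X y v"
  shows "u = v"
proof (rule extensionalityI)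
  show "u \<in> extensional {0..1}" "v \<in> extensional {0..1}" using u v by (auto simp: is_hat_def)
  have X_eq: "u z = v z" if "z \<in> X" for z using u v that by (cases "z = y") (auto simp: is_hat_def)
  fix t :: real assume t: "t \<in> {0..1}"
  show "u t = v t"
  proof (cases "t \<in> X")
    case False
    define a b where "a = Max {z\<in>X. z \<le> t}" and "b = Min {z\<in>X. t \<le> z}"
    have "a \<in> {z\<in>X. z \<le> t}" unfolding a_def using fin X t by (intro Max_in) auto
    moreover have "b \<in> {z\<in>X. t \<le> z}" unfolding b_def using fin X t by (intro Min_in) auto
    ultimately have ab: "a \<in> X" "b \<in> X" "a < t" "t < b" using False by (auto simp: less_le)
    have "z \<le> a \<or> b \<le> z" if "z \<in> X" for z
      using that fin by (cases "z \<le> t") (auto simp: a_def b_def)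
    then have gap: "X \<inter> {a<..<b} = {}" by force
    obtain m c where uc: "\<forall>s\<in>{a..b}. u s = m * s + c"
      using u ab gap unfolding is_hat_def by (meson less_trans)
    obtain m' c' where vc: "\<forall>s\<in>{a..b}. v s = m' * s + c'"
      using v ab gap unfolding is_hat_def by (meson less_trans)
    have A: "m * a + c = m' * a + c'" and B: "m * b + c = m' * b + c'"
      using X_eq[of a] X_eq[of b] uc vc ab by auto
    then have "(m - m') * (b - a) = 0" by (simp add: algebra_simps)
    then have "m = m'" using ab by simp
    then show ?thesis using A uc vc ab by auto
  qed (rule X_eq)
qed

lemma hat_equispaced:
  fixes n k :: nat
  assumes n: "n > 0" and k: "k \<le> n"
  defines "X \<equiv> (\<lambda>l. real l / real n) ` {0..n}"
  shows "is_hat X (k / n) (\<lambda>t\<in>{0..1}. max 0 (1 - \<bar>n * t - k\<bar>))" (is "is_hat X _ ?u")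
proof -
  have in01: "real l / n \<in> {0..1}" if "l \<le> n" for l using that n by auto
  have affine: "\<exists>m c. \<forall>t\<in>{a..b}. ?u t = m * t + c"
    if ab: "a \<in> X" "b \<in> X" "a < b" and gap: "X \<inter> {a<..<b} = {}" for a b
  proof -
    obtain p r where p: "p \<le> n" "a = p / n" and r: "r \<le> n" "b = r / n"
      using ab by (auto simp: X_def)
    have "p < r" using ab p r n by (simp add: divide_less_cancel)
    have "\<not> Suc p < r"
    proof
      assume "Suc p < r"
      then have "real (Suc p) / n \<in> X \<inter> {a<..<b}"
        using p r n by (auto simp: X_def divide_strict_right_mono simp del: of_nat_Suc)
      with gap show False by blast
    qed
    with \<open>p < r\<close> have rp: "r = Suc p" by simp
    have t: "t \<in> {0..1}" "p \<le> n * t" "n * t \<le> p + 1" if "t \<in> {a..b}" for t :: real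
    proof -
      have "0 \<le> a" "b \<le> 1" using in01[OF p(1)] in01[OF r(1)] p(2) r(2) by simp_all
      then show "t \<in> {0..1}" using that by auto
      show "p \<le> n * t" "n * t \<le> p + 1" using that p r n rp by (auto simp: field_simps)
    qed
    have u: "?u s = max 0 (1 - \<bar>n * s - k\<bar>)" if "s \<in> {a..b}" for s :: real
      using t(1)[OF that] by simp
    consider "p \<ge> Suc k" | "p = k" | "Suc p = k" | "Suc (Suc p) \<le> k" by linarith
    then show ?thesis
    proof cases
      case 1
      then have "real p \<ge> real k + 1" by linarith
      then have "?u s = 0 * s + 0" if "s \<in> {a..b}" for s
        unfolding u[OF that] using t(2,3)[OF that] by linarith
      then show ?thesis by blast
    next
      case 2
      then have "real p = real k" by simp
      then have "?u s = (- real n) * s + (1 + k)" if "s \<in> {a..b}" for s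
        unfolding u[OF that] using t(2,3)[OF that] by linarith
      then show ?thesis by blast
    next
      case 3
      then have "real k = real p + 1" by linarith
      then have "?u s = real n * s + (1 - real k)" if "s \<in> {a..b}" for s
        unfolding u[OF that] using t(2,3)[OF that] by linarith
      then show ?thesis by blast
    next
      case 4
      then have "real p + 2 \<le> real k" by linarith
      then have "?u s = 0 * s + 0" if "s \<in> {a..b}" for s
        unfolding u[OF that] using t(2,3)[OF that] by linarith
      then show ?thesis by blast
    qed
  qed
  have zero: "?u z = 0" if z: "z \<in> X - {k / n}" for z
  proof -
    obtain l where l: "l \<le> n" "z = l / n" "l \<noteq> k" using z by (auto simp: X_def)
    then have "\<bar>real l - real k\<bar> \<ge> 1" by linarith
    then show ?thesis using l in01[OF l(1)] n by simp
  qed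
  have cont: "continuous_on {0..1} ?u"
  proof (rule continuous_on_cong[THEN iffD1])
    show "continuous_on {0..1} (\<lambda>t::real. max 0 (1 - \<bar>n * t - k\<bar>))" by (intro continuous_intros)
  qed auto
  have one: "?u (k / n) = 1" using in01[OF k] n by simp
  show ?thesis
    unfolding is_hat_def using affine zero cont one by (intro conjI ballI impI restrict_extensional) blast+
qed

text \<open>Hence the description defining \<^const>\<open>hat\<close> denotes on the levels where it is used.\<close>

lemma is_hat_basis_fun:
  assumes "g = Classic \<or> g = Modified \<and> i \<noteq> 1" and k: "1 \<le> k" "k \<le> num_nodes g i"
  shows "is_hat (nodes g i) (node g i k) (basis_fun g i k)"
proof -
  define n :: nat where "n = 2 ^ (i - 1)"
  have n: "n > 0" "num_nodes g i = n + 1" "g \<noteq> CGL" "\<not> (g \<noteq> Classic \<and> i = 1)"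
    using assms(1) by (auto simp: n_def num_nodes_def)
  have node: "node g i l = real (l - 1) / n" if "1 \<le> l" for l
    using that n by (auto simp: node_def n_def of_nat_diff)
  have "nodes g i = (\<lambda>l. real (l - 1) / n) ` Suc ` {0..n}"
    unfolding nodes_def n(2) image_Suc_atLeastAtMost using node by (intro image_cong) auto
  then have X: "nodes g i = (\<lambda>l. real l / n) ` {0..n}" by (simp only: image_image diff_Suc_1)
  have ex: "is_hat (nodes g i) (node g i k) (\<lambda>t\<in>{0..1}. max 0 (1 - \<bar>n * t - real (k - 1)\<bar>))"
    unfolding X node[OF k(1)] using n k by (intro hat_equispaced) auto
  have X01: "finite (nodes g i)" "0 \<in> nodes g i" "1 \<in> nodes g i" "nodes g i \<subseteq> {0..1}"
    unfolding X using n by (force simp: image_iff)+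
  have "is_hat (nodes g i) (node g i k) (hat (nodes g i) (node g i k))"
    unfolding hat_def by (rule theI[where P = "is_hat (nodes g i) (node g i k)", OF ex]) (rule is_hat_unique[OF X01 _ ex])
  then show ?thesis using n by (auto simp: basis_fun_def)
qed

lemma e_bvp_eq:
  fixes x :: "real ^ 'd::finite"
  shows "e_bvp g q W V x =
    (\<Sum>i\<in>multi_indices {q - CARD('d) + 1..q}. \<Sum>k\<in>node_indices g i.
       (- 1) ^ (q - msize i) * real ((CARD('d) - 1) choose (q - msize i)) *
       point_error g W V i k * tensor_basis g i k x)"
  by (simp add: e_bvp_def sparse_interp_def point_error_def right_diff_distrib left_diff_distrib sum_subtractf)

lemma continuous_on_basis_fun:
  assumes "1 \<le> k" "k \<le> num_nodes g i"
  shows "continuous_on {0..1} (basis_fun g i k)"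
proof (cases "g = Classic \<or> g = Modified \<and> i \<noteq> 1")
  case True
  then show ?thesis using is_hat_basis_fun[OF True assms] by (simp add: is_hat_def)
next
  case False
  then have "basis_fun g i k = (\<lambda>t. 1) \<or>
             basis_fun g i k = lagrange (nodes g i) (node g i k)"
    by (cases g) (auto simp: basis_fun_def)
  then show ?thesis
    by (auto simp: lagrange_def[abs_def] divide_inverse intro!: continuous_intros)
qed

text \<open>In particular the supremum in \<^term>\<open>sup_norm (e_bvp g q W V)\<close> is a genuine one.\<close>

lemma bdd_above_e_bvp:
  "bdd_above ((\<lambda>x. \<bar>e_bvp g q W V x\<bar>) ` {x :: real ^ 'd::finite. \<forall>j. 0 \<le> x $ j \<and> x $ j \<le> 1})"
proof -
  let ?Q = "{x :: real ^ 'd. \<forall>j. 0 \<le> x $ j \<and> x $ j \<le> 1}"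
  have Q: "?Q = cbox 0 1" by (auto simp: mem_box_cart)
  have b: "continuous_on ?Q (\<lambda>x. basis_fun g m l (x $ j))"
    if "1 \<le> l" "l \<le> num_nodes g m" for m l j
    by (rule continuous_on_compose2[OF continuous_on_basis_fun[OF that]])
       (auto intro!: continuous_intros)
  have "continuous_on ?Q (\<lambda>x. \<bar>e_bvp g q W V x\<bar>)"
    unfolding e_bvp_eq tensor_basis_def
    by (intro continuous_intros b) (auto simp: node_indices_def)
  then have "compact ((\<lambda>x. \<bar>e_bvp g q W V x\<bar>) ` ?Q)"
    unfolding Q by (intro compact_continuous_image) auto
  then show ?thesis by (intro bounded_imp_bdd_above compact_imp_bounded)
qed

end

theory Submission
  imports Defs
begin

text \<open>
  At most \<open>d (q - d + 1)\<^sup>d\<^sup>-\<^sup>1\<close> multi-indices contribute to the error, each with a bounded binomial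
  weight and with a tensor product of univariate interpolation operators, whose norm is the product
  of their Lebesgue constants. Piecewise linear interpolation has bounded Lebesgue constants. For
  Chebyshev Gauss--Lobatto nodes with \<open>n = 2\<^sup>i\<^sup>-\<^sup>1\<close> and \<open>t = (1 - cos \<theta>) / 2\<close>, the node polynomial
  is a multiple of \<open>sin \<theta> sin (n \<theta>)\<close>, so the \<open>k\<close>-th Lagrange polynomial is
  \<open>O(1 / (1 + |n \<theta> / \<pi> - k|))\<close>; the Lebesgue constant is then at most a harmonic sum, hence \<open>O(i)\<close>,
  and the \<open>d\<close> factors cost an additional \<open>(q - d + 1)\<^sup>d\<close>.
\<close>

section \<open>Counting multi-indices and reduction to univariate Lebesgue constants\<close>

text \<open>The other d - 1 components are at least 1 each and use up d - 1 of the budget q.\<close>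

lemma multi_indices_component_le:
  fixes i :: "'d::finite \<Rightarrow> nat"
  assumes "CARD('d) \<le> q" "i \<in> multi_indices {..q}"
  shows "i j \<in> {1..q - CARD('d) + 1}"
proof -
  have "i j + (CARD('d) - 1) = i j + (\<Sum>l\<in>UNIV - {j}. 1)"
    by simp
  also have "\<dots> \<le> i j + (\<Sum>l\<in>UNIV - {j}. i l)"
    using assms(2) by (intro add_left_mono sum_mono) (auto simp: multi_indices_def)
  also have "\<dots> = msize i"
    unfolding msize_def by (simp add: sum.remove[of UNIV j])
  finally show ?thesis using assms by (auto simp: multi_indices_def)
qed

text \<open>A multi-index is recovered from its size and all components but one: there are d sizes
  in the range, and each of the d - 1 remaining components has q - d + 1 possible values.\<close>

lemma card_multi_indices_le:
  assumes "d = CARD('d::finite)" "d \<le> q"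
  shows "card (multi_indices {q - d + 1..q} :: ('d \<Rightarrow> nat) set) \<le> d * (q - d + 1) ^ (d - 1)"
proof -
  have le: "i j \<in> {1..q - d + 1}" if "i \<in> multi_indices {q - d + 1..q}" for i :: "'d \<Rightarrow> nat" and j
    using that assms(2) unfolding assms(1)
    by (intro multi_indices_component_le) (auto simp: multi_indices_def)
  obtain j0 :: 'd where True by simp
  let ?M = "multi_indices {q - d + 1..q} :: ('d \<Rightarrow> nat) set"
  let ?P = "(UNIV - {j0}) \<rightarrow>\<^sub>E {1..q - d + 1}"
  let ?F = "\<lambda>i. (msize i, restrict i (UNIV - {j0}))"
  have "inj_on ?F ?M"
  proof (rule inj_onI)
    fix i k :: "'d \<Rightarrow> nat" assume eq: "?F i = ?F k"
    then have off: "i j = k j" if "j \<noteq> j0" for j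
      using that by (metis (no_types, lifting) DiffI UNIV_I prod.inject restrict_apply' singletonD)
    have "i j0 + sum i (UNIV - {j0}) = k j0 + sum k (UNIV - {j0})"
      using eq by (simp add: msize_def sum.remove[of UNIV j0])
    moreover have "sum i (UNIV - {j0}) = sum k (UNIV - {j0})"
      by (rule sum.cong) (auto simp: off)
    ultimately show "i = k" using off by (metis add_right_cancel ext)
  qed
  moreover have "?F ` ?M \<subseteq> {q - d + 1..q} \<times> ?P"
  proof
    fix p assume "p \<in> ?F ` ?M"
    then obtain i where i: "i \<in> ?M" "p = ?F i" by blast
    then have "msize i \<in> {q - d + 1..q}" by (simp add: multi_indices_def)
    then show "p \<in> {q - d + 1..q} \<times> ?P" using le[OF i(1)] by (simp add: i(2))
  qed
  ultimately have "card ?M \<le> card ({q - d + 1..q} \<times> ?P)"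
    by (intro card_inj_on_le) (auto intro!: finite_cartesian_product finite_PiE)
  also have "\<dots> = d * (q - d + 1) ^ (d - 1)"
    using assms by (simp add: card_cartesian_product card_funcsetE)
  finally show "card ?M \<le> d * (q - d + 1) ^ (d - 1)" .
qed

text \<open>Both estimates of the theorem are instances of this one; only the bound B on the
  Lebesgue functions of the occurring levels differs. B may depend on q.\<close>

lemma sup_norm_e_bvp_le:
  fixes V W :: "real ^ 'd::finite \<Rightarrow> real"
  assumes d: "d = CARD('d)" "d \<le> q" and "0 < \<epsilon>"
    and err: "\<And>i k. i \<in> multi_indices {..q} \<Longrightarrow> k \<in> node_indices g i \<Longrightarrow> \<bar>point_error g W V i k\<bar> \<le> \<epsilon>"
    and lebesgue: "\<And>l t. l \<in> {1..q - d + 1} \<Longrightarrow> t \<in> {0..1} \<Longrightarrow>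
                     (\<Sum>k=1..num_nodes g l. \<bar>basis_fun g l k t\<bar>) \<le> B"
  shows "sup_norm (e_bvp g q W V) / \<epsilon> \<le> real d * 2 ^ (d - 1) * B ^ d * real (q - d + 1) ^ (d - 1)"
proof -
  let ?M = "multi_indices {q - d + 1..q} :: ('d \<Rightarrow> nat) set"
  have "0 \<le> (\<Sum>k=1..num_nodes g 1. \<bar>basis_fun g 1 k 0\<bar>)" by (simp add: sum_nonneg)
  also have "\<dots> \<le> B" using d by (intro lebesgue) auto
  finally have B: "0 \<le> B" .
  have "\<bar>e_bvp g q W V x\<bar> \<le> \<epsilon> * (real d * 2 ^ (d - 1) * B ^ d * real (q - d + 1) ^ (d - 1))"
    if x: "\<forall>j. 0 \<le> x $ j \<and> x $ j \<le> 1" for x :: "real ^ 'd"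
  proof -
    have tensor: "(\<Sum>k\<in>node_indices g i. \<bar>tensor_basis g i k x\<bar>) \<le> B ^ d" if "i \<in> ?M" for i
    proof -
      \<comment> \<open>As the node indices form a full product set, the sum of products is a
        product of d univariate sums.\<close>
      have "node_indices g i = (\<Pi>\<^sub>E j\<in>UNIV. {1..num_nodes g (i j)})"
        by (auto simp: node_indices_def)
      then have "(\<Sum>k\<in>node_indices g i. \<bar>tensor_basis g i k x\<bar>)
          = (\<Prod>j\<in>UNIV. \<Sum>k=1..num_nodes g (i j). \<bar>basis_fun g (i j) k (x $ j)\<bar>)"
        by (simp add: tensor_basis_def abs_prod prod_sum_PiE)
      also have "\<dots> \<le> (\<Prod>j\<in>(UNIV::'d set). B)"
      proof (intro prod_mono conjI sum_nonneg lebesgue)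
        show "i j \<in> {1..q - d + 1}" for j
          using that d(2) unfolding d(1)
          by (intro multi_indices_component_le) (auto simp: multi_indices_def)
      qed (use x in auto)
      finally show ?thesis by (simp add: d)
    qed
    have "\<bar>e_bvp g q W V x\<bar> \<le> (\<Sum>i\<in>?M. \<Sum>k\<in>node_indices g i.
        2 ^ (d - 1) * \<epsilon> * \<bar>tensor_basis g i k x\<bar>)"
      unfolding e_bvp_eq d(1)
    proof (intro order_trans[OF sum_abs] sum_mono)
      fix i k :: "'d \<Rightarrow> nat" assume i: "i \<in> multi_indices {q - CARD('d) + 1..q}" and k: "k \<in> node_indices g i"
      \<comment> \<open>A binomial coefficient is at most its row sum, whence the factor 2 ^ (d -
        1).\<close>
      have "real ((CARD('d) - 1) choose (q - msize i)) \<le> 2 ^ (CARD('d) - 1)"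
        by (metis binomial_le_pow2 of_nat_le_iff of_nat_numeral of_nat_power)
      moreover have "\<bar>point_error g W V i k\<bar> \<le> \<epsilon>"
        using i k by (intro err) (auto simp: multi_indices_def)
      ultimately show "\<bar>(- 1) ^ (q - msize i) * real ((CARD('d) - 1) choose (q - msize i)) *
          point_error g W V i k * tensor_basis g i k x\<bar>
          \<le> 2 ^ (CARD('d) - 1) * \<epsilon> * \<bar>tensor_basis g i k x\<bar>"
        by (auto simp: abs_mult power_abs intro!: mult_right_mono mult_mono)
    qed
    also have "\<dots> = (\<Sum>i\<in>?M. 2 ^ (d - 1) * \<epsilon> * (\<Sum>k\<in>node_indices g i. \<bar>tensor_basis g i k x\<bar>))"
      by (simp add: sum_distrib_left)
    also have "\<dots> \<le> (\<Sum>i\<in>?M. 2 ^ (d - 1) * \<epsilon> * B ^ d)"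
      using \<open>0 < \<epsilon>\<close> by (intro sum_mono mult_left_mono tensor) auto
    also have "\<dots> = real (card ?M) * (2 ^ (d - 1) * \<epsilon> * B ^ d)" by simp
    also have "\<dots> \<le> real (d * (q - d + 1) ^ (d - 1)) * (2 ^ (d - 1) * \<epsilon> * B ^ d)"
      using card_multi_indices_le[OF d] \<open>0 < \<epsilon>\<close> B
      by (intro mult_right_mono of_nat_mono) auto
    finally show ?thesis by (simp add: mult_ac)
  qed
  \<comment> \<open>The origin witnesses that the cube is nonempty, as \<open>cSUP_least\<close>
    demands.\<close>
  then have "sup_norm (e_bvp g q W V) \<le> \<epsilon> * (real d * 2 ^ (d - 1) * B ^ d * real (q - d + 1) ^ (d - 1))"
    unfolding sup_norm_def
    by (intro cSUP_least) (auto intro: exI[of _ "0 :: real ^ 'd"])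
  then show ?thesis using \<open>0 < \<epsilon>\<close> by (simp add: pos_divide_le_eq mult.commute)
qed

section \<open>Piecewise linear interpolation\<close>

text \<open>The explicit tent satisfies \<open>is_hat\<close>, and so does the basis function;
  uniqueness identifies them. Node numbers start at 1, hence the shift to k - 1.\<close>

lemma basis_fun_linear_eq:
  assumes "g = Classic \<or> g = Modified \<and> i \<noteq> 1" and k: "1 \<le> k" "k \<le> num_nodes g i"
  shows "basis_fun g i k = (\<lambda>t\<in>{0..1}. max 0 (1 - \<bar>real (2 ^ (i - 1)) * t - real (k - 1)\<bar>))"
proof -
  define n :: nat where "n = 2 ^ (i - 1)"
  have n: "n > 0" "num_nodes g i = n + 1" "g \<noteq> CGL" "\<not> (g \<noteq> Classic \<and> i = 1)"
    using assms(1) by (auto simp: n_def num_nodes_def)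
  have node: "node g i l = real (l - 1) / n" if "1 \<le> l" for l
    using that n by (auto simp: node_def n_def of_nat_diff)
  have "nodes g i = (\<lambda>l. real (l - 1) / n) ` Suc ` {0..n}"
    unfolding nodes_def n(2) image_Suc_atLeastAtMost using node by (intro image_cong) auto
  then have X: "nodes g i = (\<lambda>l. real l / n) ` {0..n}" by (simp only: image_image diff_Suc_1)
  have X01: "finite (nodes g i)" "0 \<in> nodes g i" "1 \<in> nodes g i" "nodes g i \<subseteq> {0..1}"
    unfolding X using n by (force simp: image_iff)+
  have "is_hat (nodes g i) (node g i k) (\<lambda>t\<in>{0..1}. max 0 (1 - \<bar>n * t - real (k - 1)\<bar>))"
    unfolding X node[OF k(1)] using n k by (intro hat_equispaced) auto
  then show ?thesis
    unfolding n_def by (intro is_hat_unique[OF X01 is_hat_basis_fun[OF assms]])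
qed

text \<open>Only the two integers around \<phi> can contribute, each by at most 1.\<close>

lemma sum_hat_le:
  fixes \<phi> :: real
  shows "(\<Sum>k\<le>n. max 0 (1 - \<bar>\<phi> - real k\<bar>)) \<le> 2"
proof -
  let ?S = "{k\<in>{..n}. \<bar>\<phi> - real k\<bar> < 1}"
  have "(\<Sum>k\<le>n. max 0 (1 - \<bar>\<phi> - real k\<bar>)) = (\<Sum>k\<in>?S. max 0 (1 - \<bar>\<phi> - real k\<bar>))"
    by (rule sum.mono_neutral_right) auto
  also have "\<dots> \<le> (\<Sum>k\<in>?S. 1)" by (rule sum_mono) auto
  also have "\<dots> = card ?S" by simp
  also have "card ?S \<le> card {nat \<lfloor>\<phi>\<rfloor>, nat \<lfloor>\<phi>\<rfloor> + 1}"
  proof (rule card_mono)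
    show "?S \<subseteq> {nat \<lfloor>\<phi>\<rfloor>, nat \<lfloor>\<phi>\<rfloor> + 1}"
    proof
      fix k assume "k \<in> ?S"
      then have "\<bar>\<phi> - real k\<bar> < 1" by simp
      \<comment> \<open>For negative \<phi>, \<open>nat\<close> cuts the floor off at 0, which is
        then the only k within distance 1.\<close>
      then have "int k = \<lfloor>\<phi>\<rfloor> \<or> int k = \<lfloor>\<phi>\<rfloor> + 1 \<or> k = 0 \<and> \<phi> < 0" by linarith
      then show "k \<in> {nat \<lfloor>\<phi>\<rfloor>, nat \<lfloor>\<phi>\<rfloor> + 1}" by auto
    qed
  qed simp
  finally show ?thesis by (simp add: card_insert_if)
qed

lemma lebesgue_linear:
  assumes "g \<noteq> CGL" "t \<in> {0..1}"
  shows "(\<Sum>k=1..num_nodes g i. \<bar>basis_fun g i k t\<bar>) \<le> 2"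
proof (cases "g = Classic \<or> g = Modified \<and> i \<noteq> 1")
  case True
  define n :: nat where "n = 2 ^ (i - 1)"
  have n: "num_nodes g i = Suc n" using True by (auto simp: n_def num_nodes_def)
  have "(\<Sum>k=1..num_nodes g i. \<bar>basis_fun g i k t\<bar>)
      = (\<Sum>k=1..Suc n. max 0 (1 - \<bar>real n * t - real (k - 1)\<bar>))"
    using assms(2) by (intro sum.cong) (auto simp: n n_def basis_fun_linear_eq[OF True])
  also have "\<dots> = (\<Sum>k\<le>n. max 0 (1 - \<bar>real n * t - real k\<bar>))"
    by (simp add: sum.shift_bounds_cl_Suc_ivl atLeast0AtMost del: sum.cl_ivl_Suc)
  finally show ?thesis using sum_hat_le[of "real n * t" n] by simp
next
  case False
  \<comment> \<open>What remains is level 1 of the modified grid, with the constant 1 as its single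
    basis function.\<close>
  with assms show ?thesis by (cases g) (auto simp: basis_fun_def num_nodes_def)
qed

section \<open>Lagrange polynomials and the node polynomial of the CGL grid\<close>

text \<open>The classical formula p(t) / ((t - y) p'(y)) for the Lagrange polynomial, cleared of
  denominators. The cofactor r of the root y has r(y) = p'(y) and vanishes on the rest of X, so it
  is p'(y) times the Lagrange polynomial.\<close>

lemma lagrange_mult_pderiv:
  fixes p :: "real poly"
  assumes X: "finite X" "y \<in> X" and deg: "degree p \<le> card X" and zero: "\<And>z. z \<in> X \<Longrightarrow> poly p z = 0"
  shows "lagrange X y t * (t - y) * poly (pderiv p) y = poly p t"
proof (cases "p = 0")
  case False
  obtain r where r: "p = [:- y, 1:] * r"
    using zero[OF X(2)] by (auto simp: poly_eq_0_iff_dvd)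
  have ry: "poly r y = poly (pderiv p) y"
    by (simp only: r pderiv_mult) (simp add: pderiv_pCons)
  define L where "L = (\<Prod>z\<in>X - {y}. smult (1 / (y - z)) [:- z, 1:])"
  have L: "poly L s = lagrange X y s" for s
    by (simp add: L_def lagrange_def poly_prod algebra_simps diff_divide_distrib)
  have cX: "card X > 0" using X by (auto simp: card_gt_0_iff)
  have "r = smult (poly (pderiv p) y) L"
  \<comment> \<open>Both polynomials have degree below the number of points of X, so agreement on X
    suffices.\<close>
  proof (rule poly_eqI_degree)
    show "poly r z = poly (smult (poly (pderiv p) y) L) z" if z: "z \<in> X" for z
    proof (cases "z = y")
      case True
      then show ?thesis by (auto simp: L ry lagrange_def intro!: prod.neutral)
    next
      case F: False
      have "(z - y) * poly r z = 0" using zero[OF z] by (simp add: r algebra_simps)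
      moreover have "lagrange X y z = 0"
        using F z X by (auto simp: lagrange_def prod_zero_iff)
      ultimately show ?thesis using F by (simp add: L)
    qed
    have "degree p = Suc (degree r)" using False by (subst r, subst degree_mult_eq) (auto simp: r)
    then show "degree r < card X" using deg by simp
    have "degree L \<le> (\<Sum>z\<in>X - {y}. degree (smult (1 / (y - z)) [:- z, 1:]))"
      unfolding L_def using X by (intro order_trans[OF degree_prod_sum_le]) simp_all
    also have "\<dots> \<le> (\<Sum>z\<in>X - {y}. 1)"
      by (intro sum_mono) auto
    also have "\<dots> < card X" using X cX by simp
    finally have "degree L < card X" .
    then show "degree (smult (poly (pderiv p) y) L) < card X"
      using degree_smult_le le_less_trans by blast
  qed
  then have "poly r t = poly (pderiv p) y * lagrange X y t" by (simp add: L)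
  then show ?thesis by (simp add: r algebra_simps)
qed simp

text \<open>Chebyshev polynomials of the second kind with the index shifted by one and transplanted to
  \<open>[0,1]\<close> by \<open>t = (1 - cos \<theta>) / 2\<close>.\<close>

fun cheb :: "nat \<Rightarrow> real poly" where
  "cheb 0 = 0"
| "cheb (Suc 0) = 1"
| "cheb (Suc (Suc n)) = [:2, - 4:] * cheb (Suc n) - cheb n"

text \<open>At t = (1 - cos \<theta>) / 2 the factor 2 - 4 t is 2 cos \<theta>, so the recurrence
  becomes sin((n+2)\<theta>) = 2 cos \<theta> sin((n+1)\<theta>) - sin(n\<theta>). The factor sin
  \<theta> avoids a division at the endpoints.\<close>

lemma poly_cheb_cos: "poly (cheb n) ((1 - cos \<theta>) / 2) * sin \<theta> = sin (n * \<theta>)"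
proof (induction n rule: cheb.induct)
  case (3 n)
  have "poly (cheb (Suc (Suc n))) ((1 - cos \<theta>) / 2) * sin \<theta>
      = 2 * cos \<theta> * (poly (cheb (Suc n)) ((1 - cos \<theta>) / 2) * sin \<theta>)
        - poly (cheb n) ((1 - cos \<theta>) / 2) * sin \<theta>"
    by (simp add: field_simps)
  also have "\<dots> = 2 * cos \<theta> * sin (Suc n * \<theta>) - sin (n * \<theta>)"
    by (simp only: 3)
  also have "\<dots> = sin (Suc n * \<theta> + \<theta>)"
  proof -
    have "sin (n * \<theta>) = sin (Suc n * \<theta> - \<theta>)" by (simp add: algebra_simps)
    then show ?thesis by (simp only: sin_add sin_diff) simp
  qed
  finally show ?case by (simp add: algebra_simps)
qed simp_all

lemma degree_cheb_le: "degree (cheb n) \<le> n - 1"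
proof (induction n rule: cheb.induct)
  case (3 n)
  have "degree ([:2, - 4:] * cheb (Suc n)) \<le> 1 + n"
    using degree_mult_le[of "[:2, - 4::real:]" "cheb (Suc n)"] 3(1) by simp
  then show ?case using 3(2) by (auto intro!: degree_diff_le)
qed simp_all

text \<open>Where sin \<theta> = 0, \<open>poly_cheb_cos\<close> gives no information, so the
  endpoint values are computed from the recurrence.\<close>

lemma poly_cheb_0: "poly (cheb n) 0 = n"
  by (induction n rule: cheb.induct) auto

lemma abs_poly_cheb_1: "\<bar>poly (cheb n) 1\<bar> = n"
proof -
  have "poly (cheb n) 1 = (- 1) ^ (n + 1) * n"
    by (induction n rule: cheb.induct) (auto simp: algebra_simps)
  then show ?thesis by (simp add: abs_mult power_abs)
qed

text \<open>The factor 4 t (1 - t) equals the square of sin \<theta> and adds the endpoints to the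
  zeros of \<open>cheb n\<close>: for n > 0 this is the node polynomial up to a scalar.\<close>

definition cgl_poly :: "nat \<Rightarrow> real poly" where
  "cgl_poly n = [:0, 4, - 4:] * cheb n"

lemma poly_cgl_poly_cos: "poly (cgl_poly n) ((1 - cos \<theta>) / 2) = sin \<theta> * sin (n * \<theta>)"
proof -
  have "poly (cgl_poly n) t = 4 * t * (1 - t) * poly (cheb n) t" for t
    by (simp add: cgl_poly_def algebra_simps)
  then have "poly (cgl_poly n) ((1 - cos \<theta>) / 2)
      = (4 * ((1 - cos \<theta>) / 2) * (1 - (1 - cos \<theta>) / 2)) * poly (cheb n) ((1 - cos \<theta>) / 2)" .
  also have "4 * ((1 - cos \<theta>) / 2) * (1 - (1 - cos \<theta>) / 2) = sin \<theta> * sin \<theta>"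
    using sin_squared_eq[of \<theta>] by (simp add: power2_eq_square) (simp add: field_simps)
  also have "sin \<theta> * sin \<theta> * poly (cheb n) ((1 - cos \<theta>) / 2)
      = sin \<theta> * (poly (cheb n) ((1 - cos \<theta>) / 2) * sin \<theta>)"
    by (simp only: mult_ac)
  finally show ?thesis by (simp only: poly_cheb_cos)
qed

lemma degree_cgl_poly_le: "n > 0 \<Longrightarrow> degree (cgl_poly n) \<le> n + 1"
  using degree_mult_le[of "[:0, 4, - 4::real:]" "cheb n"] degree_cheb_le[of n]
  by (simp add: cgl_poly_def)

text \<open>At interior nodes, differentiating sin \<theta> sin(n\<theta>) in \<theta> and dividing
  by dt/d\<theta> = sin \<theta> / 2 gives absolute value 2 n. At the endpoints this quotient
  degenerates, and the product rule gives 4 n.\<close>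

lemma abs_pderiv_cgl_poly_ge:
  fixes n k :: nat
  assumes "k \<le> n" "n > 0"
  shows "2 * n \<le> \<bar>poly (pderiv (cgl_poly n)) ((1 - cos (k * pi / n)) / 2)\<bar>"
proof -
  define \<theta> where "\<theta> = k * pi / n"
  have pderiv: "pderiv (cgl_poly n) = [:0, 4, - 4:] * pderiv (cheb n) + cheb n * [:4, - 8:]"
    by (simp only: cgl_poly_def pderiv_mult) (simp add: pderiv_pCons)
  consider "k = 0" | "k = n" | "0 < k" "k < n" using assms by linarith
  then show ?thesis
  proof cases
    case 3
    then have "0 < \<theta>" "\<theta> < pi" by (auto simp: \<theta>_def field_simps)
    then have pos: "sin \<theta> > 0" by (rule sin_gt_zero)
    have n\<theta>: "n * \<theta> = k * pi" using assms by (simp add: \<theta>_def)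
    have "((\<lambda>\<theta>. poly (cgl_poly n) ((1 - cos \<theta>) / 2)) has_real_derivative
        poly (pderiv (cgl_poly n)) ((1 - cos \<theta>) / 2) * (sin \<theta> / 2)) (at \<theta>)"
      by (auto intro!: derivative_eq_intros DERIV_chain2[OF poly_DERIV])
    moreover have "((\<lambda>\<theta>. sin \<theta> * sin (n * \<theta>)) has_real_derivative
        cos \<theta> * sin (n * \<theta>) + sin \<theta> * (cos (n * \<theta>) * n)) (at \<theta>)"
      by (auto intro!: derivative_eq_intros simp: algebra_simps)
    ultimately have "poly (pderiv (cgl_poly n)) ((1 - cos \<theta>) / 2) * (sin \<theta> / 2)
        = cos \<theta> * sin (n * \<theta>) + sin \<theta> * (cos (n * \<theta>) * n)"
      unfolding poly_cgl_poly_cos by (rule DERIV_unique)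
    also have "\<dots> = sin \<theta> * ((- 1) ^ k * n)" unfolding n\<theta> by simp
    finally have "poly (pderiv (cgl_poly n)) ((1 - cos \<theta>) / 2) = 2 * ((- 1) ^ k * n)"
      using pos by (simp add: field_simps)
    then show ?thesis by (simp add: \<theta>_def abs_mult power_abs)
  qed (use assms in \<open>simp_all add: pderiv poly_cheb_0 abs_mult abs_poly_cheb_1\<close>)
qed

section \<open>Trigonometric estimates and decay of the CGL Lagrange polynomials\<close>

text \<open>Jordan's inequality: the concave sine lies above its chord.\<close>

lemma sin_ge_two_div_pi:
  fixes x :: real
  assumes "0 \<le> x" "x \<le> pi / 2"
  shows "2 / pi * x \<le> sin x"
proof -
  have "convex_on {0..pi/2} (\<lambda>x. - sin x)"
    by (rule f''_ge0_imp_convex[where f' = "\<lambda>x. - cos x" and f'' = sin])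
       (auto intro!: derivative_eq_intros sin_ge_zero)
  from convex_onD[OF this, of "2 / pi * x" 0 "pi / 2"] assms show ?thesis
    by (simp add: field_simps)
qed

text \<open>With half-sum a and half-difference b, the difference of cosines is 2 |sin a| |sin b|.
  Here |sin \<theta>| is at most 2 sin a, and |\<theta> - \<alpha>| = 2 |b| is at most pi |sin b| by
  Jordan.\<close>

lemma abs_sin_mult_diff_le:
  fixes \<theta> \<alpha> :: real
  assumes "\<theta> \<in> {0..pi}" "\<alpha> \<in> {0..pi}"
  shows "\<bar>sin \<theta>\<bar> * \<bar>\<theta> - \<alpha>\<bar> \<le> pi * \<bar>cos \<theta> - cos \<alpha>\<bar>"
proof -
  define a b where "a = (\<theta> + \<alpha>) / 2" and "b = (\<theta> - \<alpha>) / 2"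
  have ab: "\<theta> = a + b" "\<alpha> = a - b" by (auto simp: a_def b_def field_simps)
  have a0: "sin a \<ge> 0" using assms by (intro sin_ge_zero) (auto simp: a_def)
  \<comment> \<open>This product is the difference of the squares of sin a and sin b, so its sign
    compares the two.\<close>
  have "0 \<le> sin (a + b) * sin (a - b)"
    using assms ab by (metis atLeastAtMost_iff mult_nonneg_nonneg sin_ge_zero)
  also have "\<dots> = (sin a)\<^sup>2 * (cos b)\<^sup>2 - (cos a)\<^sup>2 * (sin b)\<^sup>2"
    by (simp add: sin_add sin_diff power2_eq_square algebra_simps)
  also have "\<dots> = (sin a)\<^sup>2 - (sin b)\<^sup>2"
    by (simp add: cos_squared_eq algebra_simps)
  finally have "\<bar>sin b\<bar> \<le> sin a"
    using a0 by (metis abs_le_square_iff abs_of_nonneg diff_ge_0_iff_ge)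
  then have "\<bar>sin a\<bar> * \<bar>cos b\<bar> + \<bar>cos a\<bar> * \<bar>sin b\<bar> \<le> sin a * 1 + 1 * sin a"
    using a0 by (intro add_mono mult_mono) auto
  then have "\<bar>sin a * cos b + cos a * sin b\<bar> \<le> sin a * 1 + 1 * sin a"
    by (intro order_trans[OF abs_triangle_ineq]) (simp add: abs_mult)
  then have s: "\<bar>sin \<theta>\<bar> \<le> 2 * sin a" by (simp add: ab sin_add)
  have "2 / pi * \<bar>b\<bar> \<le> sin \<bar>b\<bar>"
    using assms by (intro sin_ge_two_div_pi) (auto simp: b_def)
  also have "sin \<bar>b\<bar> \<le> \<bar>sin b\<bar>" by (cases "b \<ge> 0") auto
  finally have t: "\<bar>\<theta> - \<alpha>\<bar> \<le> pi * \<bar>sin b\<bar>"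
    by (simp add: ab field_simps)
  have "\<bar>sin \<theta>\<bar> * \<bar>\<theta> - \<alpha>\<bar> \<le> (2 * sin a) * (pi * \<bar>sin b\<bar>)"
    using s t a0 by (intro mult_mono) auto
  also have "\<dots> = pi * \<bar>cos \<theta> - cos \<alpha>\<bar>"
    using a0 by (simp add: cos_diff_cos ab abs_mult)
  finally show ?thesis .
qed

text \<open>Let \<phi> = n \<theta> / pi be the position of \<theta> in units of the angular node
  spacing. The key bound |L| |\<phi> - k| \<le> |sin(n\<theta>)| is used twice: with |sin| \<le> 1,
  and with |sin(n\<theta>)| \<le> pi |\<phi> - k|, which gives |L| \<le> pi. Adding the two yields
  pi + 1.\<close>

lemma abs_lagrange_cgl_le:
  fixes n k :: nat and \<theta> :: real
  assumes n: "n > 0" and k: "k \<le> n" and \<theta>: "\<theta> \<in> {0..pi}"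
  defines "X \<equiv> (\<lambda>l. (1 - cos (real l * pi / n)) / 2) ` {..n}"
  shows "\<bar>lagrange X ((1 - cos (k * pi / n)) / 2) ((1 - cos \<theta>) / 2)\<bar>
           \<le> (pi + 1) / (1 + \<bar>n * \<theta> / pi - k\<bar>)"
proof -
  define \<alpha> where "\<alpha> = k * pi / n"
  define \<phi> where "\<phi> = n * \<theta> / pi"
  define L where "L = lagrange X ((1 - cos \<alpha>) / 2) ((1 - cos \<theta>) / 2)"
  have in_pi: "real l * pi / n \<in> {0..pi}" if "l \<le> n" for l
    using that n by (auto simp: divide_le_eq mult.commute)
  have \<phi>k: "\<phi> - k = n * (\<theta> - \<alpha>) / pi" using n by (simp add: \<phi>_def \<alpha>_def field_simps)
  have "\<bar>L\<bar> * (1 + \<bar>\<phi> - k\<bar>) \<le> pi + 1"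
  proof (cases "\<theta> = \<alpha>")
    case True
    then have "L = 1" "\<phi> = k"
      using \<phi>k by (auto simp: L_def lagrange_def intro!: prod.neutral)
    then show ?thesis by simp
  next
    case False
    have ne: "cos \<theta> \<noteq> cos \<alpha>"
      using False \<theta> in_pi[OF k] cos_inj_pi[of \<theta> \<alpha>] by (auto simp: \<alpha>_def)
    have "inj_on (\<lambda>l. (1 - cos (real l * pi / n)) / 2) {..n}"
      using n in_pi by (auto intro!: inj_onI dest!: cos_inj_pi[rotated -1])
    then have card: "card X = n + 1" by (simp add: X_def card_image)
    have "L * ((1 - cos \<theta>) / 2 - (1 - cos \<alpha>) / 2) * poly (pderiv (cgl_poly n)) ((1 - cos \<alpha>) / 2)
        = poly (cgl_poly n) ((1 - cos \<theta>) / 2)"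
      unfolding L_def
    proof (rule lagrange_mult_pderiv)
      show "finite X" "(1 - cos \<alpha>) / 2 \<in> X" using k by (auto simp: X_def \<alpha>_def)
      show "degree (cgl_poly n) \<le> card X" using degree_cgl_poly_le[OF n] card by simp
      show "poly (cgl_poly n) z = 0" if "z \<in> X" for z
        using that n by (auto simp: X_def poly_cgl_poly_cos)
    qed
    from arg_cong[OF this, of abs]
    have "\<bar>L\<bar> * \<bar>(1 - cos \<theta>) / 2 - (1 - cos \<alpha>) / 2\<bar>
          * \<bar>poly (pderiv (cgl_poly n)) ((1 - cos \<alpha>) / 2)\<bar> = \<bar>sin \<theta>\<bar> * \<bar>sin (n * \<theta>)\<bar>"
      by (simp only: poly_cgl_poly_cos abs_mult)
    moreover have "\<bar>(1 - cos \<theta>) / 2 - (1 - cos \<alpha>) / 2\<bar> = \<bar>cos \<theta> - cos \<alpha>\<bar> / 2"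
      by (simp add: abs_minus_commute flip: diff_divide_distrib)
    moreover have "\<bar>L\<bar> * (\<bar>cos \<theta> - cos \<alpha>\<bar> / 2) * (2 * n)
        \<le> \<bar>L\<bar> * (\<bar>cos \<theta> - cos \<alpha>\<bar> / 2) * \<bar>poly (pderiv (cgl_poly n)) ((1 - cos \<alpha>) / 2)\<bar>"
      unfolding \<alpha>_def using abs_pderiv_cgl_poly_ge[OF k n] by (intro mult_left_mono) auto
    ultimately have "\<bar>L\<bar> * n * \<bar>cos \<theta> - cos \<alpha>\<bar> \<le> \<bar>sin (n * \<theta>)\<bar> * \<bar>sin \<theta>\<bar>"
      by (simp add: mult_ac)
    \<comment> \<open>The factor |\<theta> - \<alpha>| lets sin \<theta> be traded for the
      difference of cosines, which then cancels, being nonzero.\<close>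
    then have "\<bar>L\<bar> * n * \<bar>cos \<theta> - cos \<alpha>\<bar> * \<bar>\<theta> - \<alpha>\<bar> \<le> \<bar>sin (n * \<theta>)\<bar> * (\<bar>sin \<theta>\<bar> * \<bar>\<theta> - \<alpha>\<bar>)"
      by (metis abs_ge_zero mult.assoc mult_right_mono)
    also have "\<dots> \<le> \<bar>sin (n * \<theta>)\<bar> * (pi * \<bar>cos \<theta> - cos \<alpha>\<bar>)"
      using abs_sin_mult_diff_le[OF \<theta> in_pi[OF k]] by (intro mult_left_mono) (auto simp: \<alpha>_def)
    finally have "(\<bar>L\<bar> * (n * \<bar>\<theta> - \<alpha>\<bar>)) * \<bar>cos \<theta> - cos \<alpha>\<bar> \<le> (pi * \<bar>sin (n * \<theta>)\<bar>) * \<bar>cos \<theta> - cos \<alpha>\<bar>"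
      by (simp add: mult_ac)
    then have "\<bar>L\<bar> * (n * \<bar>\<theta> - \<alpha>\<bar>) \<le> pi * \<bar>sin (n * \<theta>)\<bar>"
      using ne by (simp add: mult_le_cancel_right)
    then have main: "\<bar>L\<bar> * \<bar>\<phi> - k\<bar> \<le> \<bar>sin (n * \<theta>)\<bar>"
      by (simp only: \<phi>k abs_mult abs_divide) (simp add: divide_le_eq mult.commute)
    \<comment> \<open>Shifting the argument by k pi changes only the sign of the sine.\<close>
    have "n * \<theta> = pi * (\<phi> - k) + k * pi" using n by (simp add: \<phi>_def field_simps)
    then have "\<bar>sin (n * \<theta>)\<bar> = \<bar>sin (pi * (\<phi> - k))\<bar>"
      by (simp only: sin_add) (simp add: abs_mult power_abs)
    also have "\<dots> \<le> pi * \<bar>\<phi> - k\<bar>"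
      using abs_sin_x_le_abs_x[of "pi * (\<phi> - k)"] by (simp add: abs_mult)
    finally have "\<bar>L\<bar> * \<bar>\<phi> - k\<bar> \<le> pi * \<bar>\<phi> - k\<bar>" using main by linarith
    moreover have "\<bar>\<phi> - k\<bar> > 0" using False n by (simp add: \<phi>k)
    ultimately have "\<bar>L\<bar> \<le> pi" by (simp add: mult_le_cancel_right)
    moreover have "\<bar>L\<bar> * \<bar>\<phi> - k\<bar> \<le> 1" using main abs_sin_le_one[of "n * \<theta>"] by linarith
    ultimately show ?thesis by (simp add: algebra_simps)
  qed
  then show ?thesis
    unfolding L_def \<phi>_def \<alpha>_def by (subst pos_le_divide_eq) auto
qed

section \<open>Harmonic sums and the Lebesgue constant of the CGL grid\<close>

text \<open>Each dyadic block of 2 ^ j terms, none above 1 / 2 ^ j, adds at most 1.\<close>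

lemma harm_two_power_le: "harm (2 ^ j) \<le> real j + 1"
proof (induction j)
  case (Suc j)
  have "(harm (2 ^ Suc j) :: real) = (\<Sum>k\<in>{1..2 ^ j} \<union> {2 ^ j<..2 ^ Suc j :: nat}. inverse (real k))"
    unfolding harm_def by (rule sum.cong) auto
  also have "\<dots> = harm (2 ^ j) + (\<Sum>k\<in>{2 ^ j<..2 ^ Suc j :: nat}. inverse (real k))"
    unfolding harm_def by (rule sum.union_disjoint) auto
  also have "(\<Sum>k\<in>{2 ^ j<..2 ^ Suc j :: nat}. inverse (real k)) \<le> (\<Sum>k\<in>{2 ^ j<..2 ^ Suc j :: nat}. inverse (2 ^ j :: real))"
    by (intro sum_mono le_imp_inverse_le) (auto simp flip: of_nat_power)
  also have "\<dots> = 1" by simp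
  finally show ?case using Suc by simp
qed (simp add: harm_def)

text \<open>Split at m, the floor of \<phi>. To the left the denominators are at least m + 1 - k, to
  the right at least k - m, so each half is dominated by a harmonic sum.\<close>

lemma sum_inverse_distance_le:
  fixes \<phi> :: real
  assumes "0 \<le> \<phi>" "\<phi> \<le> n"
  shows "(\<Sum>k\<le>n. 1 / (1 + \<bar>\<phi> - real k\<bar>)) \<le> 2 * harm (n + 1)"
proof -
  define m where "m = nat \<lfloor>\<phi>\<rfloor>"
  have m: "real m \<le> \<phi>" "\<phi> < real m + 1" "m \<le> n"
    using assms by (auto simp: m_def) linarith+
  have "(\<Sum>k\<le>n. 1 / (1 + \<bar>\<phi> - real k\<bar>))
      = (\<Sum>k\<in>{..m} \<union> {m<..n}. 1 / (1 + \<bar>\<phi> - real k\<bar>))"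
    using m by (intro sum.cong) auto
  also have "\<dots> = (\<Sum>k\<le>m. 1 / (1 + \<bar>\<phi> - real k\<bar>)) + (\<Sum>k\<in>{m<..n}. 1 / (1 + \<bar>\<phi> - real k\<bar>))"
    by (rule sum.union_disjoint) auto
  also have "(\<Sum>k\<le>m. 1 / (1 + \<bar>\<phi> - real k\<bar>)) \<le> (\<Sum>k\<le>m. inverse (real (m + 1 - k)))"
    using m by (intro sum_mono) (auto simp: field_simps of_nat_diff)
  also have "\<dots> = harm (m + 1)"
    unfolding harm_def by (rule sum.reindex_bij_witness[of _ "\<lambda>k. m + 1 - k" "\<lambda>k. m + 1 - k"]) auto
  also have "\<dots> \<le> harm (n + 1)" using m by (intro harm_mono) auto
  also have "(\<Sum>k\<in>{m<..n}. 1 / (1 + \<bar>\<phi> - real k\<bar>)) \<le> (\<Sum>k\<in>{m<..n}. inverse (real (k - m)))"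
    using m by (intro sum_mono) (auto simp: field_simps of_nat_diff)
  also have "\<dots> = harm (n - m)"
    unfolding harm_def by (rule sum.reindex_bij_witness[of _ "\<lambda>k. k + m" "\<lambda>k. k - m"]) auto
  also have "\<dots> \<le> harm (n + 1)" by (intro harm_mono) auto
  finally show ?thesis by simp
qed

text \<open>The decay bound sums to (pi + 1) * 2 * \<open>harm (n + 1)\<close> with n = 2 ^ (i - 1),
  and this harmonic number is at most i + 1 \<le> 2 i.\<close>

lemma lebesgue_cgl:
  assumes "i \<ge> 1" "t \<in> {0..1}"
  shows "(\<Sum>k=1..num_nodes CGL i. \<bar>basis_fun CGL i k t\<bar>) \<le> 4 * (pi + 1) * real i"
proof (cases "i = 1")
  case True
  then show ?thesis using pi_gt3 by (simp add: basis_fun_def num_nodes_def)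
next
  case False
  define n :: nat where "n = 2 ^ (i - 1)"
  have n: "num_nodes CGL i = Suc n" "n > 0" using False by (auto simp: n_def num_nodes_def)
  define X where "X = (\<lambda>l. (1 - cos (real l * pi / real n)) / 2) ` {..n}"
  have node: "node CGL i (Suc k) = (1 - cos (real k * pi / real n)) / 2" for k
    using False by (simp add: node_def n_def)
  have X: "nodes CGL i = X"
    unfolding nodes_def n(1) X_def
    by (simp add: image_image node flip: atLeast0AtMost image_Suc_atLeastAtMost)
  \<comment> \<open>The angle in [0, pi] that the substitution assigns to t.\<close>
  define \<theta> where "\<theta> = arccos (1 - 2 * t)"
  have \<theta>: "\<theta> \<in> {0..pi}" "t = (1 - cos \<theta>) / 2"
    using assms(2) by (auto simp: \<theta>_def arccos_lbound arccos_ubound)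
  have "(\<Sum>k=1..num_nodes CGL i. \<bar>basis_fun CGL i k t\<bar>) = (\<Sum>k\<le>n. \<bar>basis_fun CGL i (Suc k) t\<bar>)"
    by (simp add: n(1) sum.shift_bounds_cl_Suc_ivl atLeast0AtMost del: sum.cl_ivl_Suc)
  also have "\<dots> \<le> (\<Sum>k\<le>n. (pi + 1) * (1 / (1 + \<bar>n * \<theta> / pi - k\<bar>)))"
    using abs_lagrange_cgl_le[OF n(2) _ \<theta>(1)] False
    by (intro sum_mono) (auto simp: basis_fun_def node X X_def \<theta>(2))
  also have "\<dots> = (pi + 1) * (\<Sum>k\<le>n. 1 / (1 + \<bar>n * \<theta> / pi - k\<bar>))"
    by (simp add: sum_distrib_left)
  also have "\<dots> \<le> (pi + 1) * (2 * harm (n + 1))"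
    using \<theta>(1) by (intro mult_left_mono sum_inverse_distance_le) (auto simp: pos_divide_le_eq mult_left_mono)
  also have "\<dots> \<le> (pi + 1) * (2 * (real i + real i))"
  proof (intro mult_left_mono)
    have "harm (n + 1) \<le> (harm n + 1 :: real)" by (simp add: harm_Suc field_simps)
    also have "\<dots> \<le> real i + 1"
      using harm_two_power_le[of "i - 1"] assms by (simp add: n_def of_nat_diff)
    finally show "harm (n + 1) \<le> real i + real i" using assms by linarith
  qed auto
  finally show ?thesis by (simp add: algebra_simps)
qed

section \<open>Passage to log N and conclusion\<close>

text \<open>The constant 4 combines m + 1 \<le> 2 m with ln 2 \<ge> 1/2. At m = 0 the logarithm is 0
  and the bound fails.\<close>

lemma Suc_le_ln_two_power:
  assumes "m \<ge> 1"
  shows "real (m + 1) \<le> 4 * ln (2 ^ m)"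
proof -
  have "real (m + 1) \<le> 2 * real m" using assms by simp
  also have "\<dots> \<le> 4 * (real m * ln 2)"
    using ln2_ge_two_thirds mult_left_mono[of "1/2" "ln 2" "real m"] by simp
  finally show ?thesis by (simp add: ln_realpow)
qed

theorem corollary1:
  shows "(\<forall>g\<in>{Classic, Modified}. \<exists>C>0. \<forall>\<^sub>F q in sequentially. q \<ge> CARD('d::finite) \<longrightarrow>
            (\<forall>(V :: real ^ 'd \<Rightarrow> real) W. \<forall>\<epsilon>>0.
               (\<forall>i\<in>multi_indices {..q}. \<forall>k\<in>node_indices g i. \<bar>point_error g W V i k\<bar> < \<epsilon>) \<longrightarrow>
               sup_norm (e_bvp g q W V) / \<epsilon>
                 \<le> C * ln (2 ^ (q - CARD('d)) :: real) ^ (CARD('d) - 1)))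
       \<and> (\<exists>C>0. \<forall>\<^sub>F q in sequentially. q \<ge> CARD('d) \<longrightarrow>
            (\<forall>(V :: real ^ 'd \<Rightarrow> real) W. \<forall>\<epsilon>>0.
               (\<forall>i\<in>multi_indices {..q}. \<forall>k\<in>node_indices CGL i. \<bar>point_error CGL W V i k\<bar> < \<epsilon>) \<longrightarrow>
               sup_norm (e_bvp CGL q W V) / \<epsilon>
                 \<le> C * ln (2 ^ (q - CARD('d)) :: real) ^ (2 * CARD('d) - 1)))"
proof (intro conjI ballI)
  define d where "d = CARD('d)"
  have d: "d \<ge> 1" by (simp add: d_def)
  fix g assume g: "g \<in> {Classic, Modified}"
  \<comment> \<open>The factor 2 ^ d comes from Lebesgue constant 2, and 4 ^ (d - 1) from replacing
    q - d + 1 by 4 log N.\<close>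
  let ?C = "real d * 2 ^ (d - 1) * 2 ^ d * 4 ^ (d - 1)"
  show "\<exists>C>0. \<forall>\<^sub>F q in sequentially. q \<ge> CARD('d::finite) \<longrightarrow>
            (\<forall>(V :: real ^ 'd \<Rightarrow> real) W. \<forall>\<epsilon>>0.
               (\<forall>i\<in>multi_indices {..q}. \<forall>k\<in>node_indices g i. \<bar>point_error g W V i k\<bar> < \<epsilon>) \<longrightarrow>
               sup_norm (e_bvp g q W V) / \<epsilon>
                 \<le> C * ln (2 ^ (q - CARD('d)) :: real) ^ (CARD('d) - 1))"
  \<comment> \<open>Starting at q = d + 1 makes log N positive, as the passage to logarithms
    requires.\<close>
  proof (rule exI[of _ ?C], intro conjI eventually_mono[OF eventually_ge_at_top[of "d + 1"]] allI impI)
    fix q and V W :: "real ^ 'd \<Rightarrow> real" and \<epsilon> :: real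
    assume q: "d + 1 \<le> q" and "0 < \<epsilon>"
      and err: "\<forall>i\<in>multi_indices {..q}. \<forall>k\<in>node_indices g i. \<bar>point_error g W V i k\<bar> < \<epsilon>"
    let ?l = "ln (2 ^ (q - d) :: real)"
    have "sup_norm (e_bvp g q W V) / \<epsilon> \<le> real d * 2 ^ (d - 1) * 2 ^ d * real (q - d + 1) ^ (d - 1)"
      using q \<open>0 < \<epsilon>\<close> err g
      by (intro sup_norm_e_bvp_le[OF d_def] lebesgue_linear) (auto intro: less_imp_le)
    also have "\<dots> \<le> real d * 2 ^ (d - 1) * 2 ^ d * (4 * ?l) ^ (d - 1)"
      using q by (intro mult_left_mono power_mono Suc_le_ln_two_power) auto
    finally show "sup_norm (e_bvp g q W V) / \<epsilon> \<le> ?C * ln (2 ^ (q - CARD('d)) :: real) ^ (CARD('d) - 1)"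
      by (simp add: power_mult_distrib mult_ac flip: d_def)
  qed (use d in auto)
next
  define d where "d = CARD('d)"
  have d: "d \<ge> 1" by (simp add: d_def)
  let ?C = "real d * 2 ^ (d - 1) * (4 * (pi + 1)) ^ d * 4 ^ (2 * d - 1)"
  show "\<exists>C>0. \<forall>\<^sub>F q in sequentially. q \<ge> CARD('d) \<longrightarrow>
            (\<forall>(V :: real ^ 'd \<Rightarrow> real) W. \<forall>\<epsilon>>0.
               (\<forall>i\<in>multi_indices {..q}. \<forall>k\<in>node_indices CGL i. \<bar>point_error CGL W V i k\<bar> < \<epsilon>) \<longrightarrow>
               sup_norm (e_bvp CGL q W V) / \<epsilon>
                 \<le> C * ln (2 ^ (q - CARD('d)) :: real) ^ (2 * CARD('d) - 1))"
  proof (rule exI[of _ ?C], intro conjI eventually_mono[OF eventually_ge_at_top[of "d + 1"]] allI impI)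
    have "pi + 1 > 0" using pi_gt_zero by linarith
    then show "?C > 0" using d by simp
    fix q and V W :: "real ^ 'd \<Rightarrow> real" and \<epsilon> :: real
    assume q: "d + 1 \<le> q" and "0 < \<epsilon>"
      and err: "\<forall>i\<in>multi_indices {..q}. \<forall>k\<in>node_indices CGL i. \<bar>point_error CGL W V i k\<bar> < \<epsilon>"
    let ?l = "ln (2 ^ (q - d) :: real)" and ?B = "4 * (pi + 1) * real (q - d + 1)"
    \<comment> \<open>The bound grows with the level, so its value at the highest level q - d + 1
      serves for all.\<close>
    have "(\<Sum>k=1..num_nodes CGL l. \<bar>basis_fun CGL l k t\<bar>) \<le> ?B"
      if "l \<in> {1..q - d + 1}" "t \<in> {0..1}" for l t
      using that by (intro order_trans[OF lebesgue_cgl] mult_left_mono) auto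
    then have "sup_norm (e_bvp CGL q W V) / \<epsilon> \<le> real d * 2 ^ (d - 1) * ?B ^ d * real (q - d + 1) ^ (d - 1)"
      using q \<open>0 < \<epsilon>\<close> err
      by (intro sup_norm_e_bvp_le[OF d_def]) (auto intro: less_imp_le)
    \<comment> \<open>Since B is itself a multiple of q - d + 1, its d-th power adds d to the
      exponent d - 1 from counting.\<close>
    also have "\<dots> = real d * 2 ^ (d - 1) * (4 * (pi + 1)) ^ d * real (q - d + 1) ^ (d + (d - 1))"
      by (simp only: power_mult_distrib power_add mult_ac)
    also have "d + (d - 1) = 2 * d - 1" using d by simp
    also have "real d * 2 ^ (d - 1) * (4 * (pi + 1)) ^ d * real (q - d + 1) ^ (2 * d - 1)
        \<le> real d * 2 ^ (d - 1) * (4 * (pi + 1)) ^ d * (4 * ?l) ^ (2 * d - 1)"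
      using q by (intro mult_left_mono power_mono Suc_le_ln_two_power) auto
    finally show "sup_norm (e_bvp CGL q W V) / \<epsilon> \<le> ?C * ln (2 ^ (q - CARD('d)) :: real) ^ (2 * CARD('d) - 1)"
      by (simp add: power_mult_distrib mult_ac flip: d_def)
  qed
qed

end
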